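(* Let $X$ be a Banach space and let $S=(X;X_k,k\geqslant 1)$ be an absolutely representing system of subspaces in $X$. Then there exists $\delta>0$ such that every system of closed linear subspaces $\widetilde{S}=(X;\widetilde{X}_k,k\geqslant 1)$ of $X$ satisfying $\sup_k\rho_0(X_k,\widetilde{X}_k)<\delta$ is an absolutely representing system of subspaces in $X$.
   Context: $X$ is a Banach space over $\mathbb{K}$ ($=\mathbb{R}$ or $\mathbb{C}$). A system $S=(X;X_k,k\geqslant 1)$ of closed linear subspaces of $X$ is an absolutely representing system of subspaces in $X$ if every $x\in X$ can be written as $x=\sum_{k=1}^\infty x_k$ with $x_k\in X_k$ and $\sum_{k=1}^\infty\|x_k\|<\infty$. For closed subspaces $Y,Z$ of $X$, $\rho_0(Y,Z)=\sup\{d(y,Z): y\in Y,\ \|y\|=1\}$, where $d(y,Z)$ is the distance from $y$ to $Z$ (the value is $0$ if $Y=\{0\}$). *)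

theory Defs
  imports "HOL-Analysis.Analysis"
begin

(* Banach spaces over K = R or C.  The class real_normed_field describes exactly these two
   scalar fields: a commutative real division algebra with multiplicative norm is R or C
   (Mazur).  The class banach carries the underlying real Banach space (norm, completeness);
   the K-multiplication is the parameter scale, extending the real one. *)
locale banach_space_over = vector_space scale
  for scale :: "'k::real_normed_field \<Rightarrow> 'a::banach \<Rightarrow> 'a" +
  assumes scale_of_real: "scale (of_real r) x = r *\<^sub>R x"
    and norm_scale: "norm (scale c x) = norm c * norm x"
begin

(* subspace is the one of the locale: closed under scale, not only under real scaling. *)
definition closed_subspace :: "'a set \<Rightarrow> bool"
  where "closed_subspace V \<longleftrightarrow> subspace V \<and> closed V"

(* Systems are indexed by k >= 1; the value of X at 0 is irrelevant. *)
definition subspace_system :: "(nat \<Rightarrow> 'a set) \<Rightarrow> bool"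
  where "subspace_system X \<longleftrightarrow> (\<forall>k\<ge>1. closed_subspace (X k))"

definition absolutely_representing :: "(nat \<Rightarrow> 'a set) \<Rightarrow> bool"
  where "absolutely_representing X \<longleftrightarrow> subspace_system X \<and>
    (\<forall>x. \<exists>u. (\<forall>k\<ge>1. u k \<in> X k) \<and> summable (\<lambda>k. norm (u (Suc k))) \<and>
             (\<lambda>k. u (Suc k)) sums x)"

end

(* For subspaces Y and Z the set is bounded above by 1 (as 0 is in Z), and it is nonempty
   unless Y = {0}, so Sup on the reals is the true supremum. *)
definition rho0 :: "'a::real_normed_vector set \<Rightarrow> 'a set \<Rightarrow> real"
  where "rho0 Y Z = (if Y = {0} then 0 else Sup {infdist y Z | y. y \<in> Y \<and> norm y = 1})"

lemma banach_space_over_real: "banach_space_over (scaleR :: real \<Rightarrow> 'a::banach \<Rightarrow> 'a)"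
  by unfold_locales (simp_all add: algebra_simps)

lemma banach_space_over_complex: "banach_space_over ((*) :: complex \<Rightarrow> complex \<Rightarrow> complex)"
  by unfold_locales (simp_all add: algebra_simps norm_mult scaleR_conv_of_real)

end

theory Submission
  imports Defs
begin

text \<open>
  Write \<open>V k\<close> for the subspaces, and call the cost of an absolutely convergent series
  \<open>\<Sum>k. u k\<close> with \<open>u k \<in> V k\<close> the number \<open>\<Sum>k. norm (u k)\<close>.

  An absolutely representing system represents every \<open>x\<close> with cost at most \<open>C * norm x\<close>, for one
  constant \<open>C\<close> (\<open>representation_constant\<close>). This is the open mapping theorem for the sum map from
  the \<open>l\<^sup>1\<close>-sum of the subspaces onto the space: by Baire's theorem there is an \<open>n\<close> such
  that the vectors of cost at most \<open>n\<close> are dense in some ball, so every \<open>x\<close> is approximated within \<open>norm x / 2\<close> by a vector of cost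
  at most \<open>C * norm x\<close>, and successive approximation (\<open>successive_approximation\<close>) removes the error.

  Now let \<open>\<rho>\<^sub>0(X k, Y k) < \<delta>\<close> for all \<open>k\<close>, with \<open>\<delta> = 1 / (2 * C)\<close>. Given \<open>x = (\<Sum>k. u k)\<close> with
  \<open>u k \<in> X k\<close> and cost at most \<open>C * norm x\<close>, choose \<open>v k \<in> Y k\<close> with
  \<open>norm (u k - v k) \<le> \<delta> * norm (u k)\<close>. Then \<open>\<Sum>k. v k\<close> approximates \<open>x\<close> within
  \<open>\<delta> * C * norm x = norm x / 2\<close>, at cost at most \<open>(1 + \<delta>) * C * norm x\<close>, so successive approximation
  applies again, this time to the system \<open>Y\<close>, and shows that \<open>Y\<close> is absolutely representing.
\<close>

section \<open>Vectors represented with bounded cost\<close>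

text \<open>The vectors that have an absolutely convergent representation of cost at most \<open>c\<close>. The index
  set is all of \<open>nat\<close>; a system indexed from 1 is shifted by \<open>Suc\<close>.\<close>

definition rep_set :: "(nat \<Rightarrow> 'a::real_normed_vector set) \<Rightarrow> real \<Rightarrow> 'a set"
  where "rep_set V c = {x. \<exists>u. (\<forall>k. u k \<in> V k) \<and> summable (\<lambda>k. norm (u k)) \<and>
                             (\<Sum>k. norm (u k)) \<le> c \<and> u sums x}"

lemma rep_setI:
  assumes "\<And>k. u k \<in> V k" "summable (\<lambda>k. norm (u k))" "(\<Sum>k. norm (u k)) \<le> c" "u sums x"
  shows "x \<in> rep_set V c"
  using assms unfolding rep_set_def by blast

lemma rep_setE:
  assumes "x \<in> rep_set V c"
  obtains u where "\<And>k. u k \<in> V k" "summable (\<lambda>k. norm (u k))" "(\<Sum>k. norm (u k)) \<le> c" "u sums x"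
  using assms unfolding rep_set_def by blast

lemma norm_le_of_rep_set:
  fixes V :: "nat \<Rightarrow> 'a::banach set"
  assumes "x \<in> rep_set V c"
  shows "norm x \<le> c"
proof -
  obtain u where u: "summable (\<lambda>k. norm (u k))" "(\<Sum>k. norm (u k)) \<le> c" "u sums x"
    using assms by (rule rep_setE)
  then show ?thesis
    using summable_norm[of u] by (simp add: sums_unique[symmetric])
qed

lemma rep_set_mono: "c \<le> d \<Longrightarrow> rep_set V c \<subseteq> rep_set V d"
  unfolding rep_set_def by force

lemma rep_set_scaleR:
  assumes V: "\<And>k. subspace (V k)" and x: "x \<in> rep_set V c"
  shows "t *\<^sub>R x \<in> rep_set V (\<bar>t\<bar> * c)"
proof -
  obtain u where u: "\<And>k. u k \<in> V k" "summable (\<lambda>k. norm (u k))" "(\<Sum>k. norm (u k)) \<le> c" "u sums x"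
    using x by (rule rep_setE) blast
  show ?thesis
  proof (rule rep_setI[where u = "\<lambda>k. t *\<^sub>R u k"])
    show "t *\<^sub>R u k \<in> V k" for k
      by (intro subspace_scale V u)
    show "summable (\<lambda>k. norm (t *\<^sub>R u k))"
      using u by (simp add: summable_mult)
    show "(\<Sum>k. norm (t *\<^sub>R u k)) \<le> \<bar>t\<bar> * c"
      using u by (simp add: suminf_mult mult_left_mono)
    show "(\<lambda>k. t *\<^sub>R u k) sums (t *\<^sub>R x)"
      by (rule sums_scaleR_right[OF u(4)])
  qed
qed

lemma rep_set_diff:
  assumes V: "\<And>k. subspace (V k)" and x: "x \<in> rep_set V c" and y: "y \<in> rep_set V d"
  shows "x - y \<in> rep_set V (c + d)"
proof -
  obtain u where u: "\<And>k. u k \<in> V k" "summable (\<lambda>k. norm (u k))" "(\<Sum>k. norm (u k)) \<le> c" "u sums x"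
    using x by (rule rep_setE) blast
  obtain v where v: "\<And>k. v k \<in> V k" "summable (\<lambda>k. norm (v k))" "(\<Sum>k. norm (v k)) \<le> d" "v sums y"
    using y by (rule rep_setE) blast
  have le: "norm (u k - v k) \<le> norm (u k) + norm (v k)" for k
    by (rule norm_triangle_ineq4)
  have sm: "summable (\<lambda>k. norm (u k) + norm (v k))"
    using u(2) v(2) by (rule summable_add)
  show ?thesis
  proof (rule rep_setI[where u = "\<lambda>k. u k - v k"])
    show "u k - v k \<in> V k" for k
      by (intro subspace_diff V u v)
    show sd: "summable (\<lambda>k. norm (u k - v k))"
      by (rule summable_comparison_test'[OF sm, of 0]) (simp add: le)
    have "(\<Sum>k. norm (u k - v k)) \<le> (\<Sum>k. norm (u k) + norm (v k))"
      by (rule suminf_le[OF le sd sm])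
    also have "\<dots> \<le> c + d"
      using u(3) v(3) by (simp add: suminf_add[OF u(2) v(2), symmetric])
    finally show "(\<Sum>k. norm (u k - v k)) \<le> c + d" .
    show "(\<lambda>k. u k - v k) sums (x - y)"
      by (rule sums_diff[OF u(4) v(4)])
  qed
qed

text \<open>The cost is countably subadditive. The representations of the \<open>y j\<close> are summed over \<open>j\<close>
  inside each subspace, which is where closedness of the subspaces enters.\<close>

lemma rep_set_sums:
  fixes V :: "nat \<Rightarrow> 'a::banach set"
  assumes V: "\<And>k. subspace (V k)" "\<And>k. closed (V k)"
    and y: "\<And>j. y j \<in> rep_set V (c j)" and c: "summable c"
  shows "(\<Sum>j. y j) \<in> rep_set V (\<Sum>j. c j)"
proof -
  have "\<exists>u. (\<forall>k. u k \<in> V k) \<and> summable (\<lambda>k. norm (u k)) \<and> (\<Sum>k. norm (u k)) \<le> c j \<and> u sums y j"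
    for j using y[of j] unfolding rep_set_def by blast
  then obtain u where u: "\<And>j k. u j k \<in> V k" "\<And>j. summable (\<lambda>k. norm (u j k))"
      "\<And>j. (\<Sum>k. norm (u j k)) \<le> c j" "\<And>j. u j sums y j"
    by metis
  have part_le: "(\<Sum>k<n. norm (u j k)) \<le> c j" for j n
    using sum_le_suminf[OF u(2)[of j], of "{..<n}"] u(3)[of j] by simp
  have single_le: "norm (u j k) \<le> c j" for j k
  proof -
    have "norm (u j k) \<le> (\<Sum>i<Suc k. norm (u j i))"
      by (simp add: sum_nonneg)
    then show ?thesis using part_le[of j "Suc k"] by linarith
  qed
  have sm: "summable (\<lambda>j. norm (u j k))" for k
    by (rule summable_comparison_test'[OF c, of 0]) (simp add: single_le)
  have sm_y: "summable (\<lambda>j. norm (y j))"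
    by (rule summable_comparison_test'[OF c, of 0]) (simp add: norm_le_of_rep_set[OF y])
  define w where "w k = (\<Sum>j. u j k)" for k
  have w_in: "w k \<in> V k" for k
  proof -
    have "(\<lambda>n. \<Sum>j<n. u j k) \<longlonglongrightarrow> w k"
      unfolding w_def by (rule summable_LIMSEQ[OF summable_norm_cancel[OF sm]])
    moreover have "(\<Sum>j<n. u j k) \<in> V k" for n
      by (intro subspace_sum V u)
    ultimately show ?thesis
      using closed_sequentially[OF V(2)[of k], of "\<lambda>n. \<Sum>j<n. u j k"] by blast
  qed
  have w_part: "(\<Sum>k<n. norm (w k)) \<le> (\<Sum>j. c j)" for n
  proof -
    have "(\<Sum>k<n. norm (w k)) \<le> (\<Sum>k<n. \<Sum>j. norm (u j k))"
      unfolding w_def by (intro sum_mono summable_norm sm)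
    also have "\<dots> = (\<Sum>j. \<Sum>k<n. norm (u j k))"
      by (rule suminf_sum[symmetric]) (rule sm)
    also have "\<dots> \<le> (\<Sum>j. c j)"
      by (intro suminf_le part_le c summable_sum sm)
    finally show ?thesis .
  qed
  have w_sm: "summable (\<lambda>k. norm (w k))"
    by (rule summableI_nonneg_bounded[OF _ w_part]) simp
  have w_cost: "(\<Sum>k. norm (w k)) \<le> (\<Sum>j. c j)"
    by (rule suminf_le_const[OF w_sm w_part])
  \<comment> \<open>The two orders of summation agree: the remainders of the inner series are dominated by
    \<open>2 * c j\<close>, so their sum over \<open>j\<close> tends to 0.\<close>
  define a where "a j n = norm (y j - (\<Sum>k<n. u j k))" for j n
  have a_le: "a j n \<le> 2 * c j" for j n
  proof -
    have "a j n \<le> norm (y j) + norm (\<Sum>k<n. u j k)"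
      unfolding a_def by (rule norm_triangle_ineq4)
    also have "norm (\<Sum>k<n. u j k) \<le> (\<Sum>k<n. norm (u j k))"
      by (rule norm_sum)
    finally show ?thesis
      using part_le[where j = j and n = n] norm_le_of_rep_set[OF y[of j]] by linarith
  qed
  have a_nonneg: "0 \<le> a j n" for j n
    by (simp add: a_def)
  have c2: "summable (\<lambda>j. 2 * c j)"
    by (intro summable_mult c)
  have a_sm: "summable (\<lambda>j. a j n)" for n
    by (rule summable_comparison_test'[OF c2, of 0]) (use a_le a_nonneg in simp)
  have a_lim: "(\<lambda>n. a j n) \<longlonglongrightarrow> 0" for j
  proof -
    have "(\<lambda>n. y j - (\<Sum>k<n. u j k)) \<longlonglongrightarrow> y j - y j"
      using u(4)[of j] unfolding sums_def by (intro tendsto_intros)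
    then show ?thesis
      unfolding a_def by (simp add: tendsto_norm_zero)
  qed
  have sum_a_lim: "(\<lambda>n. \<Sum>j. a j n) \<longlonglongrightarrow> (\<Sum>j. (0::real))"
    by (rule tannerys_theorem[where M = "\<lambda>j. 2 * c j", THEN conjunct2, THEN conjunct2])
      (use a_lim a_le a_nonneg c2 in \<open>auto simp: case_prod_beta intro!: always_eventually\<close>)
  have err: "norm ((\<Sum>k<n. w k) - (\<Sum>j. y j)) \<le> (\<Sum>j. a j n)" for n
  proof -
    have "(\<Sum>k<n. w k) = (\<Sum>j. \<Sum>k<n. u j k)"
      unfolding w_def by (rule suminf_sum[symmetric]) (rule summable_norm_cancel[OF sm])
    then have "(\<Sum>j. y j) - (\<Sum>k<n. w k) = (\<Sum>j. y j - (\<Sum>k<n. u j k))"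
      by (simp add: suminf_diff summable_norm_cancel[OF sm_y] summable_sum summable_norm_cancel[OF sm])
    then show ?thesis
      using summable_norm[OF a_sm[of n, unfolded a_def]]
      by (simp add: a_def norm_minus_commute)
  qed
  have "(\<lambda>n. (\<Sum>k<n. w k) - (\<Sum>j. y j)) \<longlonglongrightarrow> 0"
    by (rule Lim_null_comparison[of _ "\<lambda>n. \<Sum>j. a j n"]) (use err sum_a_lim in auto)
  then have "w sums (\<Sum>j. y j)"
    unfolding sums_def by (simp add: LIM_zero_iff)
  with w_in w_sm w_cost show ?thesis
    by (intro rep_setI)
qed

section \<open>Successive approximation and the open mapping theorem\<close>

lemma successive_approximation:
  fixes V :: "nat \<Rightarrow> 'a::banach set"
  assumes V: "\<And>k. subspace (V k)" "\<And>k. closed (V k)"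
    and q: "0 \<le> q" "q < 1" and C: "0 \<le> C"
    and approx: "\<And>x. \<exists>y \<in> rep_set V (C * norm x). norm (x - y) \<le> q * norm x"
  shows "x \<in> rep_set V (C / (1 - q) * norm x)"
proof -
  obtain f where f: "\<And>x. f x \<in> rep_set V (C * norm x)" "\<And>x. norm (x - f x) \<le> q * norm x"
    using approx by metis
  define r where "r n = ((\<lambda>z. z - f z) ^^ n) x" for n
  have r_Suc: "r (Suc n) = r n - f (r n)" for n
    by (simp add: r_def)
  have r_le: "norm (r n) \<le> q ^ n * norm x" for n
  proof (induction n)
    case 0
    then show ?case by (simp add: r_def)
  next
    case (Suc n)
    have "norm (r (Suc n)) \<le> q * norm (r n)"
      unfolding r_Suc by (rule f)
    also have "\<dots> \<le> q * (q ^ n * norm x)"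
      by (intro mult_left_mono Suc q)
    finally show ?case by simp
  qed
  have geo: "(\<lambda>n. q ^ n) sums (1 / (1 - q))"
    by (rule geometric_sums) (use q in simp)
  have part: "(\<Sum>j<n. f (r j)) = x - r n" for n
    by (induction n) (simp_all add: r_Suc, simp add: r_def)
  have "(\<lambda>n. q ^ n * norm x) \<longlonglongrightarrow> 0 * norm x"
    using q by (intro tendsto_intros LIMSEQ_power_zero) simp
  then have "r \<longlonglongrightarrow> 0"
    by (intro Lim_null_comparison[of r "\<lambda>n. q ^ n * norm x"]) (use r_le in auto)
  then have "(\<lambda>n. x - r n) \<longlonglongrightarrow> x - 0"
    by (intro tendsto_intros)
  then have "(\<lambda>j. f (r j)) sums x"
    by (simp add: sums_def part)
  then have x_eq: "(\<Sum>j. f (r j)) = x"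
    by (simp add: sums_unique[symmetric])
  have cost: "(\<lambda>j. C * (q ^ j * norm x)) sums (C * (1 / (1 - q) * norm x))"
    by (intro sums_mult sums_mult2 geo)
  have "f (r j) \<in> rep_set V (C * (q ^ j * norm x))" for j
    using f(1)[of "r j"] rep_set_mono[OF mult_left_mono[OF r_le C]] by blast
  from rep_set_sums[OF V this sums_summable[OF cost]]
  show ?thesis
    by (simp add: x_eq sums_unique[OF cost, symmetric])
qed

lemma representation_constant:
  fixes V :: "nat \<Rightarrow> 'a::banach set"
  assumes V: "\<And>k. subspace (V k)" "\<And>k. closed (V k)"
    and rep: "\<And>x. \<exists>c. x \<in> rep_set V c"
  obtains C where "C > 0" "\<And>x. x \<in> rep_set V (C * norm x)"
proof -
  define A where "A n = closure (rep_set V (real n))" for n :: nat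
  have "\<Union> (range A) = UNIV"
  proof -
    have "x \<in> \<Union> (range A)" for x
    proof -
      obtain c where "x \<in> rep_set V c" using rep by blast
      then have "x \<in> rep_set V (real (nat \<lceil>c\<rceil>))"
        using rep_set_mono[OF real_nat_ceiling_ge[of c]] by blast
      then show ?thesis
        unfolding A_def using closure_subset by blast
    qed
    then show ?thesis by blast
  qed
  have "\<exists>n. interior (A n) \<noteq> {}"
  proof (rule ccontr)
    assume "\<not> ?thesis"
    then have "euclidean interior_of \<Union> (range A) = {}"
      by (intro Baire_category_alt)
        (auto simp: A_def completely_metrizable_space_euclidean)
    then show False
      using \<open>\<Union> (range A) = UNIV\<close> by simp
  qed
  then obtain n a r where r: "r > 0" and ball: "ball a r \<subseteq> A n"
    by (metis equals0I mem_interior)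
  \<comment> \<open>Symmetry and convexity move the ball to the origin.\<close>
  have small: "\<exists>p \<in> rep_set V (real n). norm (x - p) < e" if "norm x < r" "e > 0" for x e
  proof -
    have "a + x \<in> A n" "a - x \<in> A n"
      using ball that by (auto simp: dist_norm)
    then obtain p p' where p: "p \<in> rep_set V (real n)" "dist p (a + x) < e"
        and p': "p' \<in> rep_set V (real n)" "dist p' (a - x) < e"
      using \<open>e > 0\<close> unfolding A_def closure_approachable by blast
    have "(1/2) *\<^sub>R (p - p') \<in> rep_set V (\<bar>1/2\<bar> * (real n + real n))"
      by (intro rep_set_scaleR rep_set_diff V p p')
    moreover have "x - (1/2) *\<^sub>R (p - p') = (1/2) *\<^sub>R ((a + x - p) - (a - x - p'))"
      by (simp add: algebra_simps flip: scaleR_add_left)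
    then have "norm (x - (1/2) *\<^sub>R (p - p')) \<le> (norm (a + x - p) + norm (a - x - p')) / 2"
      using norm_triangle_ineq4[of "a + x - p" "a - x - p'"] by simp
    then have "norm (x - (1/2) *\<^sub>R (p - p')) < e"
      using p(2) p'(2) by (simp add: dist_norm norm_minus_commute)
    ultimately show ?thesis by auto
  qed
  define C where "C = 2 * real n / r"
  have "C \<ge> 0"
    using r by (simp add: C_def)
  have "\<exists>y \<in> rep_set V (C * norm x). norm (x - y) \<le> 1/2 * norm x" for x
  proof (cases "x = 0")
    case True
    obtain c where "x \<in> rep_set V c" using rep by blast
    from rep_set_scaleR[OF V(1) this, of 0] True show ?thesis
      by (intro bexI[of _ 0]) auto
  next
    case False
    \<comment> \<open>Rescaled by \<open>t\<close>, the vector \<open>x\<close> has norm \<open>r / 2\<close> and so lies in the ball.\<close>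
    define t where "t = 2 * norm x / r"
    have t: "t > 0" using False r by (simp add: t_def)
    have "norm ((1/t) *\<^sub>R x) = r / 2"
      using t r False by (simp add: t_def)
    then obtain p where p: "p \<in> rep_set V (real n)" "norm ((1/t) *\<^sub>R x - p) < r / 4"
      using small[of "(1/t) *\<^sub>R x" "r / 4"] r by auto
    have "t *\<^sub>R p \<in> rep_set V (\<bar>t\<bar> * real n)"
      by (intro rep_set_scaleR V p)
    moreover have "\<bar>t\<bar> * real n = C * norm x"
      using t r by (simp add: t_def C_def)
    moreover have "norm (x - t *\<^sub>R p) \<le> 1/2 * norm x"
    proof -
      have "x - t *\<^sub>R p = t *\<^sub>R ((1/t) *\<^sub>R x - p)"
        using t by (simp add: scaleR_diff_right)
      then have "norm (x - t *\<^sub>R p) = t * norm ((1/t) *\<^sub>R x - p)"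
        using t by simp
      also have "\<dots> \<le> t * (r / 4)"
        using p t by (intro mult_left_mono) auto
      also have "\<dots> = 1/2 * norm x"
        using r by (simp add: t_def)
      finally show ?thesis .
    qed
    ultimately show ?thesis by auto
  qed
  from successive_approximation[OF V _ _ \<open>C \<ge> 0\<close> this]
  have "x \<in> rep_set V (C / (1 - 1/2) * norm x)" for x
    by simp
  moreover have "C / (1 - 1/2) * norm x \<le> (2 * C + 1) * norm x" for x :: 'a
    by (intro mult_right_mono) auto
  ultimately have "x \<in> rep_set V ((2 * C + 1) * norm x)" for x
    using rep_set_mono by blast
  with \<open>C \<ge> 0\<close> show ?thesis
    by (intro that[of "2 * C + 1"]) auto
qed

section \<open>Perturbation of the subspaces\<close>

lemma infdist_le_norm:
  assumes "0 \<in> Z"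
  shows "infdist y Z \<le> norm y"
  using infdist_le[OF assms, of y] by simp

lemma rho0_bdd_above:
  assumes "0 \<in> Z"
  shows "bdd_above {infdist y Z | y. y \<in> Y \<and> norm y = 1}"
proof (rule bdd_aboveI)
  fix m assume "m \<in> {infdist y Z | y. y \<in> Y \<and> norm y = 1}"
  then obtain y where "m = infdist y Z" "norm y = 1" by blast
  then show "m \<le> 1"
    using infdist_le_norm[OF assms, of y] by simp
qed

lemma exists_unit_vector:
  assumes "subspace Y" "Y \<noteq> {0}"
  obtains y where "y \<in> Y" "norm y = 1"
proof -
  obtain z where "z \<in> Y" "z \<noteq> 0"
    using assms subspace_0 by blast
  then show ?thesis
    using assms by (intro that[of "(1 / norm z) *\<^sub>R z"]) (auto intro: subspace_scale)
qed

lemma rho0_le_1: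
  assumes "subspace Y" "0 \<in> Z"
  shows "rho0 Y Z \<le> 1"
proof (cases "Y = {0}")
  case False
  obtain y where y: "y \<in> Y" "norm y = 1"
    using assms(1) False by (rule exists_unit_vector)
  have "Sup {infdist y Z | y. y \<in> Y \<and> norm y = 1} \<le> 1"
  proof (rule cSup_least)
    fix m assume "m \<in> {infdist y Z | y. y \<in> Y \<and> norm y = 1}"
    then obtain y where "m = infdist y Z" "norm y = 1" by blast
    then show "m \<le> 1"
      using infdist_le_norm[OF assms(2), of y] by simp
  qed (use y in blast)
  with False show ?thesis by (simp add: rho0_def)
qed (simp add: rho0_def)

lemma near_vector_of_rho0:
  assumes Y: "subspace Y" and Z: "subspace Z" and less: "rho0 Y Z < \<delta>" and u: "u \<in> Y"
  shows "\<exists>v \<in> Z. norm (u - v) \<le> \<delta> * norm u"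
proof (cases "u = 0")
  case True
  then show ?thesis
    using subspace_0[OF Z] by (intro bexI[of _ 0]) auto
next
  case False
  define y where "y = (1 / norm u) *\<^sub>R u"
  have y: "y \<in> Y" "norm y = 1"
    using False u Y by (auto simp: y_def intro: subspace_scale)
  have "infdist y Z \<le> rho0 Y Z"
  proof -
    have "infdist y Z \<le> Sup {infdist y Z | y. y \<in> Y \<and> norm y = 1}"
      by (rule cSup_upper[OF _ rho0_bdd_above[OF subspace_0[OF Z]]]) (use y in blast)
    moreover have "Y \<noteq> {0}" using u False by blast
    ultimately show ?thesis by (simp add: rho0_def)
  qed
  moreover have "Z \<noteq> {}"
    using subspace_0[OF Z] by blast
  ultimately have "(INF z\<in>Z. dist y z) < \<delta>"
    using less infdist_notempty[of Z y] by linarith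
  moreover have "bdd_below (dist y ` Z)"
    by (rule bdd_belowI2[of _ 0]) simp
  ultimately obtain z where z: "z \<in> Z" "dist y z < \<delta>"
    using cINF_less_iff[OF \<open>Z \<noteq> {}\<close>] by blast
  have "u - norm u *\<^sub>R z = norm u *\<^sub>R (y - z)"
    using False by (simp add: y_def scaleR_diff_right)
  then have "norm (u - norm u *\<^sub>R z) = norm u * dist y z"
    by (simp add: dist_norm)
  also have "\<dots> \<le> \<delta> * norm u"
    using mult_right_mono[OF less_imp_le[OF z(2)], of "norm u"] by (simp add: mult.commute)
  finally show ?thesis
    using z subspace_scale[OF Z] by blast
qed

lemma perturbed_representation:
  fixes V W :: "nat \<Rightarrow> 'a::banach set"
  assumes near: "\<And>k u. u \<in> V k \<Longrightarrow> \<exists>v \<in> W k. norm (u - v) \<le> \<delta> * norm u"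
    and \<delta>: "0 \<le> \<delta>" and x: "x \<in> rep_set V c"
  shows "\<exists>y \<in> rep_set W ((1 + \<delta>) * c). norm (x - y) \<le> \<delta> * c"
proof -
  obtain u where u: "\<And>k. u k \<in> V k" "summable (\<lambda>k. norm (u k))" "(\<Sum>k. norm (u k)) \<le> c" "u sums x"
    using x by (rule rep_setE) blast
  obtain v where v: "\<And>k. v k \<in> W k" "\<And>k. norm (u k - v k) \<le> \<delta> * norm (u k)"
    using near[OF u(1)] by metis
  have v_le: "norm (v k) \<le> (1 + \<delta>) * norm (u k)" for k
    using v(2)[of k] norm_triangle_sub[of "v k" "u k"]
    by (simp add: norm_minus_commute algebra_simps)
  have sm: "summable (\<lambda>k. t * norm (u k))" for t
    by (intro summable_mult u)
  have v_sm: "summable (\<lambda>k. norm (v k))"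
    by (rule summable_comparison_test'[OF sm[of "1 + \<delta>"], of 0]) (simp add: v_le)
  have d_sm: "summable (\<lambda>k. norm (u k - v k))"
    by (rule summable_comparison_test'[OF sm[of \<delta>], of 0]) (simp add: v)
  have v_sums: "v sums (\<Sum>k. v k)"
    by (rule summable_sums[OF summable_norm_cancel[OF v_sm]])
  have "(\<Sum>k. norm (v k)) \<le> (\<Sum>k. (1 + \<delta>) * norm (u k))"
    by (rule suminf_le[OF v_le v_sm sm])
  also have "\<dots> \<le> (1 + \<delta>) * c"
    using u \<delta> by (simp add: suminf_mult mult_left_mono)
  finally have "(\<Sum>k. v k) \<in> rep_set W ((1 + \<delta>) * c)"
    using v(1) v_sm v_sums by (intro rep_setI[where u = v])
  moreover have "norm (x - (\<Sum>k. v k)) \<le> \<delta> * c"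
  proof -
    have "x - (\<Sum>k. v k) = (\<Sum>k. u k - v k)"
      by (rule sums_unique[OF sums_diff[OF u(4) v_sums]])
    also have "norm \<dots> \<le> (\<Sum>k. norm (u k - v k))"
      by (rule summable_norm[OF d_sm])
    also have "\<dots> \<le> (\<Sum>k. \<delta> * norm (u k))"
      by (rule suminf_le[OF v(2) d_sm sm])
    also have "\<dots> \<le> \<delta> * c"
      using u \<delta> by (simp add: suminf_mult mult_left_mono)
    finally show ?thesis .
  qed
  ultimately show ?thesis by blast
qed

context banach_space_over
begin

lemma subspace_system_real:
  assumes "subspace_system X" "k \<ge> 1"
  shows "Real_Vector_Spaces.subspace (X k)" "closed (X k)"
proof -
  have sub: "subspace (X k)" and "closed (X k)"
    using assms by (auto simp: subspace_system_def closed_subspace_def)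
  then show "closed (X k)" by blast
  show "Real_Vector_Spaces.subspace (X k)"
    unfolding Real_Vector_Spaces.subspace_def
    using subspace_0[OF sub] subspace_add[OF sub] subspace_scale[OF sub]
    by (auto simp flip: scale_of_real)
qed

lemma absolutely_representing_iff_rep_set:
  "absolutely_representing X \<longleftrightarrow>
     subspace_system X \<and> (\<forall>x. \<exists>c. x \<in> rep_set (\<lambda>k. X (Suc k)) c)"
proof -
  have "(\<exists>u. (\<forall>k\<ge>1. u k \<in> X k) \<and> summable (\<lambda>k. norm (u (Suc k))) \<and> (\<lambda>k. u (Suc k)) sums x)
      \<longleftrightarrow> (\<exists>c. x \<in> rep_set (\<lambda>k. X (Suc k)) c)" (is "?L \<longleftrightarrow> ?R") for x
  proof
    assume ?L
    then obtain u where "\<forall>k\<ge>1. u k \<in> X k" "summable (\<lambda>k. norm (u (Suc k)))"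
        "(\<lambda>k. u (Suc k)) sums x"
      by blast
    then show ?R
      by (intro exI[of _ "\<Sum>k. norm (u (Suc k))"] rep_setI[where u = "\<lambda>k. u (Suc k)"]) auto
  next
    assume ?R
    then obtain c where "x \<in> rep_set (\<lambda>k. X (Suc k)) c" by blast
    then obtain u where "\<And>k. u k \<in> X (Suc k)" "summable (\<lambda>k. norm (u k))" "u sums x"
      by (rule rep_setE) blast
    moreover have "u (k - 1) \<in> X k" if "k \<ge> 1" for k
      using calculation(1)[of "k - 1"] that by simp
    ultimately show ?L
      by (intro exI[of _ "\<lambda>k. u (k - 1)"]) auto
  qed
  then show ?thesis
    by (simp add: absolutely_representing_def)
qed

lemma absolutely_representing_stable:
  assumes "absolutely_representing X"
  shows "\<exists>\<delta>>0. \<forall>Y. subspace_system Y \<and> (SUP k\<in>{1..}. rho0 (X k) (Y k)) < \<delta>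
           \<longrightarrow> absolutely_representing Y"
proof -
  have X: "subspace_system X" and rep: "\<And>x. \<exists>c. x \<in> rep_set (\<lambda>k. X (Suc k)) c"
    using assms by (auto simp: absolutely_representing_iff_rep_set)
  note X_real = subspace_system_real[OF X]
  obtain C where C: "C > 0" "\<And>x. x \<in> rep_set (\<lambda>k. X (Suc k)) (C * norm x)"
    using representation_constant[OF _ _ rep] X_real by (metis le_add1 plus_1_eq_Suc)
  define \<delta> where "\<delta> = 1 / (2 * C)"
  have \<delta>: "\<delta> > 0" "\<delta> * C = 1/2"
    using C by (auto simp: \<delta>_def)
  have "absolutely_representing Y"
    if Y: "subspace_system Y" and sup: "(SUP k\<in>{1..}. rho0 (X k) (Y k)) < \<delta>" for Y
  proof -
    note Y_real = subspace_system_real[OF Y]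
    have bdd: "bdd_above ((\<lambda>k. rho0 (X k) (Y k)) ` {1..})"
    proof (rule bdd_aboveI2)
      fix k :: nat assume "k \<in> {1..}"
      then show "rho0 (X k) (Y k) \<le> 1"
        by (intro rho0_le_1 X_real real_vector.subspace_0 Y_real) auto
    qed
    have less: "rho0 (X k) (Y k) < \<delta>" if "k \<ge> 1" for k
      using cSUP_upper[OF _ bdd, of k] that sup by simp
    have near: "\<exists>v \<in> Y (Suc k). norm (u - v) \<le> \<delta> * norm u" if "u \<in> X (Suc k)" for k u
      by (rule near_vector_of_rho0[OF X_real(1) Y_real(1) less that]) auto
    have approx: "\<exists>y \<in> rep_set (\<lambda>k. Y (Suc k)) ((1 + \<delta>) * C * norm x). norm (x - y) \<le> 1/2 * norm x"
      for x
      using perturbed_representation[where V = "\<lambda>k. X (Suc k)" and W = "\<lambda>k. Y (Suc k)",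
          OF near less_imp_le[OF \<delta>(1)] C(2)[of x]] \<delta>(2)
      by (simp flip: mult.assoc)
    have "x \<in> rep_set (\<lambda>k. Y (Suc k)) ((1 + \<delta>) * C / (1 - 1/2) * norm x)" for x
      by (rule successive_approximation[OF _ _ _ _ _ approx]) (use Y_real \<delta> C in auto)
    with Y show ?thesis
      by (auto simp: absolutely_representing_iff_rep_set)
  qed
  with \<delta>(1) show ?thesis by blast
qed

end

theorem mainTheorem13:
  fixes scale :: "'k::real_normed_field \<Rightarrow> 'a::banach \<Rightarrow> 'a"
    and X :: "nat \<Rightarrow> 'a set"
  assumes "banach_space_over scale"
    and "banach_space_over.absolutely_representing scale X"
  shows "\<exists>\<delta>>0. \<forall>Y :: nat \<Rightarrow> 'a set.
    banach_space_over.subspace_system scale Y \<and> (SUP k\<in>{1..}. rho0 (X k) (Y k)) < \<delta>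
      \<longrightarrow> banach_space_over.absolutely_representing scale Y"
  by (rule banach_space_over.absolutely_representing_stable[OF assms])

end
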